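(* Let $A=B+\mathrm{i}C\in M_n(\mathbb{C})$ be a generalized Higham matrix, i.e. $B=B^{*}>0$ and $C=C^{*}>0$ are $n\times n$ Hermitian positive definite matrices. Let $\kappa=\max\{\kappa(B),\kappa(C)\}$ be the maximum of the spectral condition numbers of $B$ and $C$, and let $\rho_n(A)$ be the growth factor of $A$ in Gaussian elimination without pivoting. Then $$\frac{4\kappa}{(1+\kappa)^2}\le \rho_n(A)\le \frac{2(1+\kappa^2)}{(1+\kappa)^2}.$$
   Context: $M_n(\mathbb{C})$ is the set of $n\times n$ complex matrices, $\mathrm{i}=\sqrt{-1}$, and $B^{*}$ is the conjugate transpose of $B$. For Hermitian matrices, $B>0$ means that $B$ is positive definite. A matrix $A\in M_n(\mathbb{C})$ is a generalized Higham matrix if in its Toeplitz (Hermitian) decomposition $A=B+\mathrm{i}C$ with $B=B^{*}$, $C=C^{*}$, both $B$ and $C$ are positive definite. The spectral condition number of a nonsingular matrix $M$ is $\kappa(M)=\sqrt{\lambda_{\max}(M^{*}M)/\lambda_{\min}(M^{*}M)}$, the ratio of its largest to its smallest singular value. The growth factor of $A=(a_{ij})$ in Gaussian elimination without pivoting is $$\rho_n(A)=\frac{\max_{i,j,k}|a^{(k)}_{ij}|}{\max_{i,j}|a_{ij}|},$$ where $A^{(k)}=(a^{(k)}_{ij})$ is the $n\times n$ matrix obtained by applying the first $k$ steps of Gaussian elimination (without row or column interchanges) to $A$; here $1\le i,j\le n$ and $0\le k\le n-1$, with $A^{(0)}=A$, and $A^{(n-1)}$ is the upper triangular factor in the $LU$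 factorization of $A$. *)

theory Defs
  imports "Jordan_Normal_Form.Schur_Decomposition" "Jordan_Normal_Form.Char_Poly"
begin

definition hermitian_mat :: "complex mat \<Rightarrow> bool" where
  "hermitian_mat B \<longleftrightarrow> square_mat B \<and> mat_adjoint B = B"

(* For Hermitian B the form v* B v is real, so taking the real part loses nothing. *)
definition pos_def_mat :: "complex mat \<Rightarrow> bool" where
  "pos_def_mat B \<longleftrightarrow> hermitian_mat B \<and>
     (\<forall>v \<in> carrier_vec (dim_row B). v \<noteq> 0\<^sub>v (dim_row B) \<longrightarrow> Re ((B *\<^sub>v v) \<bullet>c v) > 0)"

(* Extreme real eigenvalues; applied to Hermitian matrices of positive size only, whose
   eigenvalues are all real. *)
definition lambda_max :: "complex mat \<Rightarrow> real" where
  "lambda_max H = Max {r. eigenvalue H (complex_of_real r)}"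

definition lambda_min :: "complex mat \<Rightarrow> real" where
  "lambda_min H = Min {r. eigenvalue H (complex_of_real r)}"

definition spectral_cond :: "complex mat \<Rightarrow> real" where
  "spectral_cond M = sqrt (lambda_max (mat_adjoint M * M) / lambda_min (mat_adjoint M * M))"

(* One elimination step with pivot row and column k, where indices start at 0. If the pivot is 0
   the step is undefined mathematically; here the multipliers then become 0 because x / 0 = 0.
   Columns j < k are unaffected after k successful steps, since then A (k, j) = 0. *)
definition ge_step :: "nat \<Rightarrow> complex mat \<Rightarrow> complex mat" where
  "ge_step k A = mat (dim_row A) (dim_col A) (\<lambda>(i, j).
     if k < i then A $$ (i, j) - (A $$ (i, k) / A $$ (k, k)) * A $$ (k, j) else A $$ (i, j))"

(* ge_iter A k is A^(k), the matrix after the first k steps; the (k+1)-st step has pivot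
   position k in 0-based indexing. *)
primrec ge_iter :: "complex mat \<Rightarrow> nat \<Rightarrow> complex mat" where
  "ge_iter A 0 = A"
| "ge_iter A (Suc k) = ge_step k (ge_iter A k)"

definition growth_factor :: "complex mat \<Rightarrow> real" where
  "growth_factor A =
     Max {cmod (ge_iter A k $$ (i, j)) | i j k. i < dim_row A \<and> j < dim_row A \<and> k < dim_row A}
     / Max {cmod (A $$ (i, j)) | i j. i < dim_row A \<and> j < dim_row A}"

end

theory Submission
  imports Defs
begin

text \<open>The lower bound carries no information about elimination: \<open>4\<kappa> \<le> (1 + \<kappa>)\<^sup>2\<close>, while the growth
  factor is at least 1 because the matrix itself is among the matrices \<open>A\<^bsup>(k)\<^esup>\<close>.

  Put \<open>r = (\<kappa> - 1) / (\<kappa> + 1)\<close>, so that the upper bound is \<open>1 + r\<^sup>2\<close>. A row of \<open>A\<^bsup>(k)\<^esup>\<close> with index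
  below \<open>k\<close> no longer changes, and the columns below \<open>k\<close> of the other rows have been cleared. Hence only
  the entries of the Schur complement \<open>S = A\<^sub>2\<^sub>2 - Z\<close> with \<open>Z = A\<^sub>2\<^sub>1 A\<^sub>1\<^sub>1\<^bsup>-1\<^esup> A\<^sub>1\<^sub>2\<close> matter. Two facts
  about them are combined.

  The first is a bound with constant 2 that only needs semidefiniteness
  (\<open>accretive_dissipative_schur_bound\<close>). Write \<open>a(u,v)\<close> for the form of \<open>A\<close> and \<open>g\<close> for the quadratic
  form of \<open>B + C\<close>. Cauchy--Schwarz for \<open>B\<close> and \<open>C\<close> gives \<open>|a(u,v)|\<^sup>2 \<le> g(u) g(v)\<close>, and
  \<open>g(u) \<le> \<surd>2 |a(u,u)|\<close> because \<open>a(u,u)\<close> has real and imaginary parts coming from \<open>B\<close> and \<open>C\<close>.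
  The row \<open>i\<close> of \<open>S\<close> is \<open>p\<^sup>* A\<close> for a vector \<open>p\<close> that differs from the unit vector \<open>e\<^sub>i\<close> only in leading
  coordinates, where \<open>p\<^sup>* A\<close> vanishes; therefore \<open>a(p,p) = a(p,e\<^sub>i)\<close>. The two inequalities then
  give \<open>g(p) \<le> 2 g(e\<^sub>i)\<close>, and so \<open>|S\<^sub>i\<^sub>j|\<^sup>2 = |a(p,e\<^sub>j)|\<^sup>2 \<le> 2 g(e\<^sub>i) g(e\<^sub>j) \<le> 4 |A\<^sub>i\<^sub>i| |A\<^sub>j\<^sub>j|\<close>.

  The second is the Wielandt inequality (\<open>wielandt\<close>): if the spectrum of a positive definite
  matrix lies in \<open>[m, \<kappa> m]\<close>, its form satisfies \<open>|b(u,v)|\<^sup>2 \<le> r\<^sup>2 b(u,u) b(v,v)\<close> for orthogonal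
  \<open>u\<close> and \<open>v\<close>. Consequently, \<open>B\<close> and \<open>C\<close> stay positive semidefinite when their trailing blocks
  are multiplied by \<open>r\<^sup>2\<close> (\<open>psd_scale_trailing\<close>). The first fact thus applies to
  the scaled matrix and bounds the entries of \<open>r\<^sup>2 A\<^sub>2\<^sub>2 - Z\<close> by \<open>2 r\<^sup>2 max |A\<^sub>i\<^sub>j|\<close>. Since
  \<open>S = (1 - r\<^sup>2) A\<^sub>2\<^sub>2 + (r\<^sup>2 A\<^sub>2\<^sub>2 - Z)\<close>, the entries of \<open>S\<close> are at most
  \<open>(1 - r\<^sup>2 + 2 r\<^sup>2) max |A\<^sub>i\<^sub>j|\<close>.

  It remains to connect the spectral condition number with the Rayleigh bounds
  \<open>m |u|\<^sup>2 \<le> b(u,u) \<le> \<kappa> m |u|\<^sup>2\<close>; this is \<open>spectral_cond_rayleigh_bounds\<close>.\<close>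

section \<open>Sesquilinear forms and the Cauchy--Schwarz inequality\<close>

text \<open>Vectors and matrices are plain functions here, of which only the values below \<open>n\<close> count: this
  makes it painless to cut a vector into a leading and a trailing part of the same length.\<close>

definition sesq :: "nat \<Rightarrow> (nat \<Rightarrow> nat \<Rightarrow> complex) \<Rightarrow> (nat \<Rightarrow> complex) \<Rightarrow> (nat \<Rightarrow> complex) \<Rightarrow> complex"
  where "sesq n X u v = (\<Sum>i<n. \<Sum>j<n. cnj (u i) * X i j * v j)"

definition sqnorm :: "nat \<Rightarrow> (nat \<Rightarrow> complex) \<Rightarrow> real"
  where "sqnorm n u = (\<Sum>i<n. (cmod (u i))\<^sup>2)"

definition herm :: "nat \<Rightarrow> (nat \<Rightarrow> nat \<Rightarrow> complex) \<Rightarrow> bool"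
  where "herm n X \<longleftrightarrow> (\<forall>i<n. \<forall>j<n. cnj (X i j) = X j i)"

definition psd :: "nat \<Rightarrow> (nat \<Rightarrow> nat \<Rightarrow> complex) \<Rightarrow> bool"
  where "psd n X \<longleftrightarrow> herm n X \<and> (\<forall>u. 0 \<le> Re (sesq n X u u))"

definition unitv :: "nat \<Rightarrow> nat \<Rightarrow> complex"
  where "unitv i j = (if j = i then 1 else 0)"

lemma sesq_add_left: "sesq n X (\<lambda>i. u i + u' i) v = sesq n X u v + sesq n X u' v"
  by (simp add: sesq_def algebra_simps sum.distrib)

lemma sesq_add_right: "sesq n X u (\<lambda>i. v i + v' i) = sesq n X u v + sesq n X u v'"
  by (simp add: sesq_def algebra_simps sum.distrib)

lemma sesq_scale_left: "sesq n X (\<lambda>i. c * u i) v = cnj c * sesq n X u v"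
  by (simp add: sesq_def sum_distrib_left mult_ac)

lemma sesq_scale_right: "sesq n X u (\<lambda>i. c * v i) = c * sesq n X u v"
  by (simp add: sesq_def sum_distrib_left mult_ac)

lemma sesq_add_form:
  "sesq n (\<lambda>i j. X i j + Y i j) u v = sesq n X u v + sesq n Y u v"
  by (simp add: sesq_def algebra_simps sum.distrib)

lemma sesq_scale_form: "sesq n (\<lambda>i j. c * X i j) u v = c * sesq n X u v"
  by (simp add: sesq_def sum_distrib_left mult_ac)

lemma sesq_cong:
  assumes "\<And>i. i < n \<Longrightarrow> u i = u' i" "\<And>j. j < n \<Longrightarrow> v j = v' j"
    "\<And>i j. i < n \<Longrightarrow> j < n \<Longrightarrow> X i j = X' i j"
  shows "sesq n X u v = sesq n X' u' v'"
  unfolding sesq_def using assms by (intro sum.cong) auto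

lemma sesq_unitv_right:
  assumes "j < n"
  shows "sesq n X u (unitv j) = (\<Sum>i<n. cnj (u i) * X i j)"
proof -
  have "(\<Sum>l<n. cnj (u i) * X i l * unitv j l) = (\<Sum>l<n. if l = j then cnj (u i) * X i l else 0)" for i
    by (intro sum.cong) (auto simp: unitv_def)
  then show ?thesis unfolding sesq_def using assms by simp
qed

lemma sesq_unitv:
  assumes "i < n" "j < n"
  shows "sesq n X (unitv i) (unitv j) = X i j"
proof -
  have "sesq n X (unitv i) (unitv j) = (\<Sum>l<n. if l = i then X l j else 0)"
    unfolding sesq_unitv_right[OF assms(2)] by (intro sum.cong) (auto simp: unitv_def)
  then show ?thesis using assms by simp
qed

lemma sesq_expand_right:
  "sesq n X u v = (\<Sum>j<n. (\<Sum>i<n. cnj (u i) * X i j) * v j)"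
  unfolding sesq_def by (subst sum.swap) (simp add: sum_distrib_right)

lemma sesq_swap:
  assumes "herm n X"
  shows "sesq n X v u = cnj (sesq n X u v)"
proof -
  have "cnj (sesq n X u v) = (\<Sum>i<n. \<Sum>j<n. u i * cnj (X i j) * cnj (v j))"
    by (simp add: sesq_def)
  also have "\<dots> = (\<Sum>i<n. \<Sum>j<n. u i * X j i * cnj (v j))"
    using assms by (intro sum.cong) (auto simp: herm_def)
  also have "\<dots> = (\<Sum>j<n. \<Sum>i<n. u i * X j i * cnj (v j))"
    by (rule sum.swap)
  finally show ?thesis by (simp add: sesq_def mult_ac)
qed

lemma sesq_diag_real:
  assumes "herm n X"
  shows "sesq n X u u = complex_of_real (Re (sesq n X u u))"
  using sesq_swap[OF assms, of u u] by (metis Reals_cnj_iff complex_is_Real_iff of_real_Re)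

lemma sqnorm_nonneg: "0 \<le> sqnorm n u"
  by (simp add: sqnorm_def sum_nonneg)

lemma sqnorm_eq_0_iff: "sqnorm n u = 0 \<longleftrightarrow> (\<forall>i<n. u i = 0)"
  by (auto simp: sqnorm_def sum_nonneg_eq_0_iff)

lemma sesq_id: "sesq n (\<lambda>i j. if i = j then c else 0) u v = c * (\<Sum>i<n. cnj (u i) * v i)"
proof -
  have "(\<Sum>j<n. cnj (u i) * (if i = j then c else 0) * v j)
      = (\<Sum>j<n. if i = j then c * (cnj (u i) * v j) else 0)" for i
    by (intro sum.cong) auto
  then show ?thesis unfolding sesq_def by (simp add: sum_distrib_left)
qed

lemma sum_cnj_mult_self: "(\<Sum>i<n. cnj (u i) * u i) = complex_of_real (sqnorm n u)"
  unfolding sqnorm_def of_real_sum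
  by (intro sum.cong refl) (simp add: complex_norm_square mult.commute del: of_real_power)

lemma sesq_sum_square:
  assumes "herm n X"
  shows "Re (sesq n X (\<lambda>i. u i + s * v i) (\<lambda>i. u i + s * v i))
    = Re (sesq n X u u) + 2 * Re (s * sesq n X u v) + (cmod s)\<^sup>2 * Re (sesq n X v v)"
proof -
  have 1: "sesq n X (\<lambda>i. u i + s * v i) (\<lambda>i. u i + s * v i)
    = sesq n X u u + s * sesq n X u v + cnj s * sesq n X v u + s * cnj s * sesq n X v v"
    by (simp add: sesq_add_left sesq_add_right sesq_scale_left sesq_scale_right algebra_simps)
  have 2: "Re (cnj s * sesq n X v u) = Re (s * sesq n X u v)"
    by (subst sesq_swap[OF assms]) simp
  have 3: "s * cnj s = complex_of_real ((cmod s)\<^sup>2)"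
    by (rule complex_norm_square[symmetric])
  show ?thesis unfolding 1 3 by (simp only: plus_complex.sel 2) simp
qed

text \<open>The case \<open>c = 0\<close> is what lets Cauchy--Schwarz hold for degenerate forms, such as
  those left after the trailing block is scaled down.\<close>

lemma quadratic_nonneg_discriminant:
  fixes a b c :: real
  assumes q: "\<And>x. 0 \<le> a - 2 * x * b + x\<^sup>2 * c" and "0 \<le> c" "0 \<le> b"
  shows "b\<^sup>2 \<le> a * c"
proof (cases "c = 0")
  case True
  have "b = 0"
  proof (rule ccontr)
    assume "b \<noteq> 0"
    then show False
      using q[of "(a + 1) / (2 * b)"] True by (simp add: field_simps)
  qed
  then show ?thesis using True by simp
next
  case False
  then have "0 \<le> c * (a - 2 * (b / c) * b + (b / c)\<^sup>2 * c)"
    using q[of "b / c"] assms(2) by (intro mult_nonneg_nonneg) auto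
  also have "\<dots> = a * c - b\<^sup>2"
    using False by (simp add: field_simps power2_eq_square)
  finally show ?thesis by simp
qed

lemma mult_le_square_mean:
  fixes x y :: real
  shows "x * y \<le> ((x + y) / 2)\<^sup>2"
  using zero_le_power2[of "x - y"] by (simp add: power2_eq_square field_simps)

lemma psd_cauchy_schwarz:
  assumes X: "psd n X"
  shows "(cmod (sesq n X u v))\<^sup>2 \<le> Re (sesq n X u u) * Re (sesq n X v v)"
proof (rule quadratic_nonneg_discriminant)
  let ?b = "sesq n X u v"
  fix x :: real
  \<comment> \<open>the phase that turns \<open>sesq n X u v\<close> into minus its modulus\<close>
  define s where "s = - complex_of_real x * cnj (sgn ?b)"
  have "sgn ?b * cmod ?b = ?b"
    by (simp add: sgn_eq)
  then have "s * ?b = - complex_of_real x * (cnj (sgn ?b) * sgn ?b) * cmod ?b"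
    unfolding s_def by (metis mult.assoc)
  also have "\<dots> = - complex_of_real x * cmod ?b"
  proof (cases "?b = 0")
    case False
    then have "cnj (sgn ?b) * sgn ?b = 1"
      using complex_norm_square[of "sgn ?b"] by (simp add: norm_sgn mult.commute)
    then show ?thesis by simp
  qed simp
  finally have sb: "Re (s * ?b) = - x * cmod ?b" by simp
  have "(cmod s)\<^sup>2 \<le> x\<^sup>2"
    by (simp add: s_def norm_mult norm_sgn power_mult_distrib)
  moreover have "0 \<le> Re (sesq n X v v)" using X by (simp add: psd_def)
  ultimately have "(cmod s)\<^sup>2 * Re (sesq n X v v) \<le> x\<^sup>2 * Re (sesq n X v v)"
    by (rule mult_right_mono)
  moreover have "0 \<le> Re (sesq n X u u) + 2 * Re (s * ?b) + (cmod s)\<^sup>2 * Re (sesq n X v v)"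
    using X sesq_sum_square[of n X u s v] unfolding psd_def by metis
  ultimately show "0 \<le> Re (sesq n X u u) - 2 * x * cmod ?b + x\<^sup>2 * Re (sesq n X v v)"
    unfolding sb by linarith
  show "0 \<le> Re (sesq n X v v)" "0 \<le> cmod ?b"
    using X by (simp_all add: psd_def)
qed

section \<open>Schur complements of accretive-dissipative forms\<close>

text \<open>When \<open>p\<close> agrees with \<open>x\<close> outside a subspace on which \<open>A p\<close> vanishes, the hypothesis on \<open>p\<close>
  holds and \<open>A p y\<close> is the value at \<open>(x, y)\<close> of the Schur complement with respect to that subspace.
  The form \<open>g\<close> of \<open>B + C\<close> dominates \<open>A\<close> in the sense of Cauchy--Schwarz and is in turn
  controlled by the diagonal of \<open>A\<close>; so the energy \<open>g p\<close> is at most twice \<open>g x\<close>. The factor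
  \<open>\<surd>2\<close> lost in that control enters four times in the square, which is the constant 4.\<close>

lemma accretive_dissipative_schur_bound:
  assumes B: "psd n B" and C: "psd n C"
    and A: "\<And>u v. A u v = sesq n B u v + \<i> * sesq n C u v"
    and p: "A p p = A p x"
  shows "(cmod (A p y))\<^sup>2 \<le> 4 * cmod (A x x) * cmod (A y y)"
proof -
  define b where "b u = Re (sesq n B u u)" for u
  define c where "c u = Re (sesq n C u u)" for u
  define g where "g u = b u + c u" for u
  have b0: "0 \<le> b u" and c0: "0 \<le> c u" for u
    using B C by (auto simp: b_def c_def psd_def)
  then have g0: "0 \<le> g u" for u by (simp add: g_def)
  have bounded: "(cmod (A u v))\<^sup>2 \<le> g u * g v" for u v
  proof -
    let ?s = "cmod (sesq n B u v)" and ?t = "cmod (sesq n C u v)"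
    have s: "?s\<^sup>2 \<le> b u * b v" and t: "?t\<^sup>2 \<le> c u * c v"
      using psd_cauchy_schwarz[OF B] psd_cauchy_schwarz[OF C] by (auto simp: b_def c_def)
    have "(?s * ?t)\<^sup>2 \<le> (b u * b v) * (c u * c v)"
      unfolding power_mult_distrib using s t b0 c0 by (intro mult_mono) auto
    also have "\<dots> = (b u * c v) * (b v * c u)" by simp
    also have "\<dots> \<le> ((b u * c v + b v * c u) / 2)\<^sup>2"
      by (rule mult_le_square_mean)
    finally have st: "?s * ?t \<le> (b u * c v + b v * c u) / 2"
      by (rule power2_le_imp_le) (simp add: b0 c0)
    have "cmod (A u v) \<le> ?s + ?t"
      unfolding A by (metis norm_triangle_ineq norm_mult norm_ii mult_1)
    then have "(cmod (A u v))\<^sup>2 \<le> (?s + ?t)\<^sup>2"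
      by (rule power_mono) simp
    also have "\<dots> \<le> g u * g v"
      using s t st by (simp add: g_def power2_sum algebra_simps)
    finally show ?thesis .
  qed
  have coercive: "(g u)\<^sup>2 \<le> 2 * (cmod (A u u))\<^sup>2" for u
  proof -
    have "sesq n B u u = complex_of_real (b u)" "sesq n C u u = complex_of_real (c u)"
      unfolding b_def c_def using B C by (auto simp only: psd_def intro!: sesq_diag_real)
    then have "A u u = Complex (b u) (c u)"
      unfolding A by (simp add: complex_eq_iff)
    then have "(cmod (A u u))\<^sup>2 = (b u)\<^sup>2 + (c u)\<^sup>2" by (simp add: cmod_power2)
    then show ?thesis using zero_le_power2[of "b u - c u"]
      by (simp add: g_def power2_eq_square algebra_simps)
  qed
  have gp: "g p \<le> 2 * g x"
  proof (cases "g p = 0")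
    case True then show ?thesis using g0[of x] by simp
  next
    case False
    have "g p * g p \<le> g p * (2 * g x)"
      using coercive[of p] bounded[of p x] unfolding p power2_eq_square by linarith
    then show ?thesis using False g0[of p] by simp
  qed
  have coercive': "g u \<le> sqrt 2 * cmod (A u u)" for u
  proof (rule power2_le_imp_le)
    show "(g u)\<^sup>2 \<le> (sqrt 2 * cmod (A u u))\<^sup>2"
      using coercive[of u] by (simp add: power_mult_distrib)
  qed simp
  have "(cmod (A p y))\<^sup>2 \<le> g p * g y" by (rule bounded)
  also have "\<dots> \<le> (2 * g x) * g y" using gp g0 by (intro mult_right_mono) auto
  also have "\<dots> \<le> (2 * (sqrt 2 * cmod (A x x))) * (sqrt 2 * cmod (A y y))"
    using coercive' g0 by (intro mult_mono) auto
  also have "\<dots> = 4 * cmod (A x x) * cmod (A y y)" by simp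
  finally show ?thesis .
qed

section \<open>The Wielandt inequality\<close>

text \<open>For a Hermitian \<open>2 \<times> 2\<close> matrix with spectrum in \<open>[1, \<kappa>]\<close>, diagonal \<open>x, y\<close> and off-diagonal entry
  of squared modulus \<open>z\<close>, the two hypotheses on \<open>z\<close> say that the determinants of the shifts by \<open>1\<close> and by
  \<open>\<kappa>\<close> are nonnegative. With determinant \<open>D\<close> and trace \<open>T\<close> they read \<open>D \<ge> T - 1\<close>
  and \<open>D \<ge> \<kappa> T - \<kappa>\<^sup>2\<close>. The claim is \<open>(1 + \<kappa>)\<^sup>2 D \<ge> 4 \<kappa> x y\<close>, and the sharper
  \<open>(1 + \<kappa>)\<^sup>2 D \<ge> \<kappa> T\<^sup>2\<close> follows from the first bound when \<open>T \<le> 1 + \<kappa>\<close> and from the second one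
  otherwise: in each case the difference factors, with \<open>1 + \<kappa>\<close> as one of the roots in \<open>T\<close>.\<close>

lemma wielandt_scalar:
  fixes x y z \<kappa> :: real
  assumes "1 \<le> x" "x \<le> \<kappa>" "1 \<le> y" "y \<le> \<kappa>"
    and lo: "z \<le> (x - 1) * (y - 1)" and hi: "z \<le> (\<kappa> - x) * (\<kappa> - y)"
  shows "(1 + \<kappa>)\<^sup>2 * z \<le> (\<kappa> - 1)\<^sup>2 * (x * y)"
proof -
  define D where "D = x * y - z"
  define T where "T = x + y"
  have k: "1 \<le> \<kappa>" and T2: "2 \<le> T" "T \<le> 2 * \<kappa>" using assms by (auto simp: T_def)
  have amgm: "4 * (x * y) \<le> T\<^sup>2"
    using zero_le_power2[of "x - y"] by (simp add: T_def power2_eq_square algebra_simps)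
  have "\<kappa> * T\<^sup>2 \<le> (1 + \<kappa>)\<^sup>2 * D"
  proof (cases "T \<le> 1 + \<kappa>")
    case True
    have "\<kappa> * 2 \<le> \<kappa> * T" using T2 k by (intro mult_left_mono) auto
    then have "1 + \<kappa> \<le> \<kappa> * T" using k by linarith
    then have "0 \<le> (\<kappa> * T - (1 + \<kappa>)) * ((1 + \<kappa>) - T)"
      using True by (intro mult_nonneg_nonneg) auto
    also have "\<dots> = (1 + \<kappa>)\<^sup>2 * (T - 1) - \<kappa> * T\<^sup>2"
      by (simp add: power2_eq_square algebra_simps)
    finally have "\<kappa> * T\<^sup>2 \<le> (1 + \<kappa>)\<^sup>2 * (T - 1)" by simp
    also have "\<dots> \<le> (1 + \<kappa>)\<^sup>2 * D"
      using lo by (intro mult_left_mono) (simp_all add: D_def T_def algebra_simps)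
    finally show ?thesis .
  next
    case False
    have "\<kappa> * 2 \<le> \<kappa> * (1 + \<kappa>)" using k by (intro mult_left_mono) auto
    then have "T \<le> \<kappa> * (1 + \<kappa>)" using T2 by linarith
    then have "0 \<le> \<kappa> * ((T - (1 + \<kappa>)) * (\<kappa> * (1 + \<kappa>) - T))"
      using False k by (intro mult_nonneg_nonneg) auto
    also have "\<dots> = (1 + \<kappa>)\<^sup>2 * (\<kappa> * T - \<kappa>\<^sup>2) - \<kappa> * T\<^sup>2"
      by (simp add: power2_eq_square algebra_simps)
    finally have "\<kappa> * T\<^sup>2 \<le> (1 + \<kappa>)\<^sup>2 * (\<kappa> * T - \<kappa>\<^sup>2)" by simp
    also have "\<kappa> * T - \<kappa>\<^sup>2 \<le> D"
      using hi by (simp add: D_def T_def power2_eq_square algebra_simps)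
    finally show ?thesis by (simp add: mult_left_mono)
  qed
  moreover have "\<kappa> * (4 * (x * y)) \<le> \<kappa> * T\<^sup>2" using amgm k by (intro mult_left_mono) auto
  ultimately have "4 * \<kappa> * (x * y) \<le> (1 + \<kappa>)\<^sup>2 * D" by simp
  then show ?thesis by (simp add: D_def power2_eq_square algebra_simps)
qed

lemma psd_shift_below:
  assumes "herm n X" "\<And>u. m * sqnorm n u \<le> Re (sesq n X u u)"
  shows "psd n (\<lambda>i j. X i j + (if i = j then - complex_of_real m else 0))"
  using assms unfolding psd_def sesq_add_form sesq_id sum_cnj_mult_self by (auto simp: herm_def)

lemma psd_shift_above:
  assumes "herm n X" "\<And>u. Re (sesq n X u u) \<le> M * sqnorm n u"
  shows "psd n (\<lambda>i j. - 1 * X i j + (if i = j then complex_of_real M else 0))"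
  using assms unfolding psd_def sesq_add_form sesq_scale_form sesq_id sum_cnj_mult_self
  by (auto simp: herm_def)

text \<open>Cauchy--Schwarz for the semidefinite forms \<open>X - m\<close> and \<open>\<kappa> m - X\<close>: orthogonality removes the
  shift from the mixed term, and what is left is the two-dimensional inequality after
  normalising by \<open>m |u|\<^sup>2\<close> and \<open>m |v|\<^sup>2\<close>.\<close>

lemma wielandt:
  assumes X: "herm n X" and m: "0 < m"
    and lo: "\<And>u. m * sqnorm n u \<le> Re (sesq n X u u)"
    and hi: "\<And>u. Re (sesq n X u u) \<le> \<kappa> * m * sqnorm n u"
    and orth: "(\<Sum>i<n. cnj (u i) * v i) = 0"
  shows "(1 + \<kappa>)\<^sup>2 * (cmod (sesq n X u v))\<^sup>2
    \<le> (\<kappa> - 1)\<^sup>2 * (Re (sesq n X u u) * Re (sesq n X v v))"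
proof (cases "sqnorm n u = 0 \<or> sqnorm n v = 0")
  case True
  then have "sesq n X u v = 0" by (auto simp: sqnorm_eq_0_iff sesq_def)
  moreover have "0 \<le> Re (sesq n X w w)" for w
    using lo[of w] m sqnorm_nonneg[of n w] by (meson less_imp_le mult_nonneg_nonneg order_trans)
  ultimately show ?thesis by simp
next
  case False
  define U V where "U = m * sqnorm n u" and "V = m * sqnorm n v"
  have UV: "0 < U" "0 < V"
    using False m sqnorm_nonneg[of n u] sqnorm_nonneg[of n v] by (auto simp: U_def V_def)
  let ?a = "Re (sesq n X u u)" and ?c = "Re (sesq n X v v)" and ?b = "(cmod (sesq n X u v))\<^sup>2"
  have 1: "?b \<le> (?a - U) * (?c - V)"
    using psd_cauchy_schwarz[OF psd_shift_below[OF X lo], of u v]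
    unfolding sesq_add_form sesq_id orth sum_cnj_mult_self by (simp add: U_def V_def)
  have 2: "?b \<le> (\<kappa> * U - ?a) * (\<kappa> * V - ?c)"
    using psd_cauchy_schwarz[OF psd_shift_above[OF X hi], of u v]
    unfolding sesq_add_form sesq_scale_form sesq_id orth sum_cnj_mult_self
    by (simp add: U_def V_def mult_ac)
  have 3: "(1 + \<kappa>)\<^sup>2 * (?b / (U * V)) \<le> (\<kappa> - 1)\<^sup>2 * ((?a / U) * (?c / V))"
  proof (rule wielandt_scalar)
    show "1 \<le> ?a / U" "?a / U \<le> \<kappa>" "1 \<le> ?c / V" "?c / V \<le> \<kappa>"
      using lo[of u] lo[of v] hi[of u] hi[of v] UV by (auto simp: field_simps U_def V_def)
    have "(?a / U - 1) * (?c / V - 1) = (?a - U) * (?c - V) / (U * V)"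
      using UV by (simp add: field_simps)
    then show "?b / (U * V) \<le> (?a / U - 1) * (?c / V - 1)"
      using 1 UV by (simp add: divide_right_mono)
    have "(\<kappa> - ?a / U) * (\<kappa> - ?c / V) = (\<kappa> * U - ?a) * (\<kappa> * V - ?c) / (U * V)"
      using UV by (simp add: field_simps)
    then show "?b / (U * V) \<le> (\<kappa> - ?a / U) * (\<kappa> - ?c / V)"
      using 2 UV by (simp add: divide_right_mono)
  qed
  have "(1 + \<kappa>)\<^sup>2 * ?b = (U * V) * ((1 + \<kappa>)\<^sup>2 * (?b / (U * V)))" using UV by simp
  also have "\<dots> \<le> (U * V) * ((\<kappa> - 1)\<^sup>2 * ((?a / U) * (?c / V)))"
    using 3 UV by (intro mult_left_mono) auto
  also have "\<dots> = (\<kappa> - 1)\<^sup>2 * (?a * ?c)" using UV by simp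
  finally show ?thesis .
qed

definition scale_trailing :: "nat \<Rightarrow> real \<Rightarrow> (nat \<Rightarrow> nat \<Rightarrow> complex) \<Rightarrow> nat \<Rightarrow> nat \<Rightarrow> complex"
  where "scale_trailing k c X i j = (if k \<le> i \<and> k \<le> j then complex_of_real c * X i j else X i j)"

text \<open>The parts \<open>l\<close> and \<open>t\<close> of a vector supported on the leading and on the trailing indices are orthogonal, so
  the Wielandt inequality bounds the mixed term of the scaled form by the geometric mean of
  its two diagonal terms. Scaling the block by \<open>r\<^sup>2\<close>, rather than dividing the off-diagonal blocks by \<open>r\<close>,
  covers \<open>\<kappa> = 1\<close>, where \<open>r = 0\<close>.\<close>

lemma psd_scale_trailing:
  assumes X: "herm n X" and m: "0 < m" and \<kappa>: "1 \<le> \<kappa>"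
    and lo: "\<And>u. m * sqnorm n u \<le> Re (sesq n X u u)"
    and hi: "\<And>u. Re (sesq n X u u) \<le> \<kappa> * m * sqnorm n u"
  shows "psd n (scale_trailing k (((\<kappa> - 1) / (\<kappa> + 1))\<^sup>2) X)"
proof -
  define r where "r = (\<kappa> - 1) / (\<kappa> + 1)"
  have "psd n (scale_trailing k (r\<^sup>2) X)"
    unfolding psd_def
  proof (intro conjI allI)
    show "herm n (scale_trailing k (r\<^sup>2) X)"
      using X by (auto simp: herm_def scale_trailing_def)
    fix u
    define l t :: "nat \<Rightarrow> complex"
      where "l i = (if i < k then u i else 0)" and "t i = (if k \<le> i then u i else 0)" for i
    let ?a = "Re (sesq n X l l)" and ?c = "Re (sesq n X t t)" and ?b = "sesq n X l t"
    have "sesq n (scale_trailing k (r\<^sup>2) X) u u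
        = sesq n (scale_trailing k (r\<^sup>2) X) (\<lambda>i. l i + t i) (\<lambda>i. l i + t i)"
      by (intro sesq_cong) (auto simp: l_def t_def)
    also have "\<dots> = sesq n X l l + ?b + sesq n X t l + complex_of_real (r\<^sup>2) * sesq n X t t"
    proof -
      have "sesq n (scale_trailing k (r\<^sup>2) X) l v = sesq n X l v" for v
        unfolding sesq_def by (intro sum.cong) (auto simp: scale_trailing_def l_def)
      moreover have "sesq n (scale_trailing k (r\<^sup>2) X) t l = sesq n X t l"
        unfolding sesq_def by (intro sum.cong) (auto simp: scale_trailing_def l_def)
      moreover have "sesq n (scale_trailing k (r\<^sup>2) X) t t = complex_of_real (r\<^sup>2) * sesq n X t t"
        unfolding sesq_scale_form[symmetric]
        unfolding sesq_def by (intro sum.cong) (auto simp: scale_trailing_def t_def)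
      ultimately show ?thesis by (simp add: sesq_add_left sesq_add_right)
    qed
    finally have form: "Re (sesq n (scale_trailing k (r\<^sup>2) X) u u) = ?a + 2 * Re ?b + r\<^sup>2 * ?c"
      using sesq_swap[OF X, of t l] by simp
    have nonneg: "0 \<le> Re (sesq n X w w)" for w
      using lo[of w] m sqnorm_nonneg[of n w] by (meson less_imp_le mult_nonneg_nonneg order_trans)
    have "(\<Sum>i<n. cnj (l i) * t i) = 0"
      by (intro sum.neutral) (auto simp: l_def t_def)
    from wielandt[OF X m lo hi this] have "(cmod ?b)\<^sup>2 \<le> r\<^sup>2 * (?a * ?c)"
      using \<kappa> by (simp add: r_def power_divide field_simps)
    also have "\<dots> = ?a * (r\<^sup>2 * ?c)" by simp
    also have "\<dots> \<le> ((?a + r\<^sup>2 * ?c) / 2)\<^sup>2"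
      by (rule mult_le_square_mean)
    finally have "cmod ?b \<le> (?a + r\<^sup>2 * ?c) / 2"
      by (rule power2_le_imp_le) (use nonneg in \<open>simp\<close>)
    moreover have "- cmod ?b \<le> Re ?b" using abs_Re_le_cmod[of ?b] by linarith
    ultimately show "0 \<le> Re (sesq n (scale_trailing k (r\<^sup>2) X) u u)"
      unfolding form by (simp add: field_simps)
  qed
  then show ?thesis by (simp only: r_def)
qed

section \<open>Extreme eigenvalues and the spectral condition number\<close>

abbreviation entries :: "complex mat \<Rightarrow> nat \<Rightarrow> nat \<Rightarrow> complex"
  where "entries X \<equiv> (\<lambda>i j. X $$ (i, j))"

lemma sesq_mult_vec: "sesq n X u v = (\<Sum>i<n. cnj (u i) * (\<Sum>j<n. X i j * v j))"
  by (simp add: sesq_def sum_distrib_left mult.assoc)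

lemma norm_sq_le_sqnorm:
  assumes "i < n"
  shows "(cmod (u i))\<^sup>2 \<le> sqnorm n u"
  unfolding sqnorm_def using assms by (intro member_le_sum) auto

lemma sqnorm_mult_vec_le:
  obtains K where "0 < K" "\<And>u. sqnorm n (\<lambda>i. \<Sum>j<n. X i j * u j) \<le> K * sqnorm n u"
proof -
  define K where "K = (\<Sum>i<n. (\<Sum>j<n. cmod (X i j))\<^sup>2)"
  have K0: "0 \<le> K" by (simp add: K_def sum_nonneg)
  have "sqnorm n (\<lambda>i. \<Sum>j<n. X i j * u j) \<le> (K + 1) * sqnorm n u" for u
  proof -
    have "(cmod (\<Sum>j<n. X i j * u j))\<^sup>2 \<le> (\<Sum>j<n. cmod (X i j))\<^sup>2 * sqnorm n u" for i
    proof -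
      have "cmod (\<Sum>j<n. X i j * u j) \<le> (\<Sum>j<n. cmod (X i j) * sqrt (sqnorm n u))"
      proof (rule sum_norm_le)
        fix j assume "j \<in> {..<n}"
        then have "cmod (u j) \<le> sqrt (sqnorm n u)"
          using norm_sq_le_sqnorm[of j n u] by (simp add: real_le_rsqrt)
        then show "cmod (X i j * u j) \<le> cmod (X i j) * sqrt (sqnorm n u)"
          unfolding norm_mult by (rule mult_left_mono) simp
      qed
      then have "(cmod (\<Sum>j<n. X i j * u j))\<^sup>2 \<le> (\<Sum>j<n. cmod (X i j) * sqrt (sqnorm n u))\<^sup>2"
        by (rule power_mono) simp
      then show ?thesis
        by (simp add: sum_distrib_right[symmetric] power_mult_distrib sqnorm_nonneg)
    qed
    then have "sqnorm n (\<lambda>i. \<Sum>j<n. X i j * u j)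
        \<le> (\<Sum>i<n. (\<Sum>j<n. cmod (X i j))\<^sup>2 * sqnorm n u)"
      unfolding sqnorm_def[of n "\<lambda>i. \<Sum>j<n. X i j * u j"] by (intro sum_mono)
    also have "\<dots> = K * sqnorm n u" by (simp add: K_def sum_distrib_right)
    finally show ?thesis using sqnorm_nonneg[of n u] by (simp add: algebra_simps)
  qed
  with K0 that[of "K + 1"] show thesis by simp
qed

lemma sesq_bounded:
  obtains K where "0 < K" "\<And>u. cmod (sesq n X u u) \<le> K * sqnorm n u"
proof -
  define K where "K = (\<Sum>i<n. \<Sum>j<n. cmod (X i j))"
  have K0: "0 \<le> K" by (simp add: K_def sum_nonneg)
  have "cmod (sesq n X u u) \<le> (K + 1) * sqnorm n u" for u
  proof -
    have "cmod (sesq n X u u) \<le> (\<Sum>i<n. \<Sum>j<n. cmod (X i j) * sqnorm n u)"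
      unfolding sesq_def
    proof (intro sum_norm_le)
      fix i j assume "i \<in> {..<n}" "j \<in> {..<n}"
      then have "cmod (u i) * cmod (u j) \<le> sqrt (sqnorm n u) * sqrt (sqnorm n u)"
        using norm_sq_le_sqnorm[of _ n u] by (intro mult_mono) (auto simp: real_le_rsqrt sqnorm_nonneg)
      then have "cmod (X i j) * (cmod (u i) * cmod (u j)) \<le> cmod (X i j) * sqnorm n u"
        using sqnorm_nonneg[of n u] by (intro mult_left_mono) auto
      then show "cmod (cnj (u i) * X i j * u j) \<le> cmod (X i j) * sqnorm n u"
        by (simp add: norm_mult mult_ac)
    qed
    also have "\<dots> = K * sqnorm n u" by (simp add: K_def sum_distrib_right)
    finally show ?thesis using sqnorm_nonneg[of n u] by (simp add: algebra_simps)
  qed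
  with K0 that[of "K + 1"] show thesis by simp
qed

lemma sesq_eq_0_of_sqnorm_eq_0:
  assumes "sqnorm n u = 0"
  shows "sesq n X u u = 0"
  using assms by (simp add: sqnorm_eq_0_iff sesq_def)

text \<open>With \<open>w = P u\<close>, Cauchy--Schwarz gives \<open>|w|\<^sup>4 = |(P w, u)|\<^sup>2 \<le> (P w, w) (P u, u) \<le> K |w|\<^sup>2 (P u, u)\<close>, so the
  form bounds \<open>|w|\<^sup>2\<close>, and \<open>u = Q w\<close> is bounded by \<open>w\<close>.\<close>

lemma psd_invertible_coercive:
  assumes P: "psd n P" and inv: "\<And>i j. i < n \<Longrightarrow> j < n \<Longrightarrow> (\<Sum>l<n. Q i l * P l j) = (if i = j then 1 else 0)"
  obtains e where "0 < e" "\<And>u. e * sqnorm n u \<le> Re (sesq n P u u)"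
proof -
  obtain K where K: "0 < K" "\<And>u. cmod (sesq n P u u) \<le> K * sqnorm n u"
    using sesq_bounded[of n P] by blast
  obtain L where L: "0 < L" "\<And>u. sqnorm n (\<lambda>i. \<Sum>j<n. Q i j * u j) \<le> L * sqnorm n u"
    using sqnorm_mult_vec_le[of n Q] by blast
  have "1 / (L * K) * sqnorm n u \<le> Re (sesq n P u u)" for u
  proof -
    define w where "w i = (\<Sum>j<n. P i j * u j)" for i
    have nonneg: "0 \<le> Re (sesq n P u u)" using P by (simp add: psd_def)
    have "(\<Sum>j<n. Q i j * w j) = u i" if "i < n" for i
    proof -
      have "(\<Sum>j<n. Q i j * w j) = (\<Sum>j<n. \<Sum>l<n. Q i j * P j l * u l)"
        by (simp add: w_def sum_distrib_left mult.assoc)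
      also have "\<dots> = (\<Sum>l<n. (\<Sum>j<n. Q i j * P j l) * u l)"
        by (subst sum.swap) (simp add: sum_distrib_right)
      also have "\<dots> = (\<Sum>l<n. if i = l then u l else 0)"
        using that by (intro sum.cong) (auto simp: inv)
      also have "\<dots> = u i" using that by simp
      finally show ?thesis .
    qed
    then have "sqnorm n (\<lambda>i. \<Sum>j<n. Q i j * w j) = sqnorm n u"
      unfolding sqnorm_def by (intro sum.cong) auto
    then have uw: "sqnorm n u \<le> L * sqnorm n w" using L(2)[of w] by simp
    have w: "sqnorm n w \<le> K * Re (sesq n P u u)"
    proof (cases "sqnorm n w = 0")
      case False
      have "sesq n P w u = complex_of_real (sqnorm n w)"
        unfolding sesq_mult_vec w_def[symmetric] by (rule sum_cnj_mult_self)
      then have "(sqnorm n w)\<^sup>2 \<le> Re (sesq n P w w) * Re (sesq n P u u)"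
        using psd_cauchy_schwarz[OF P, of w u] by simp
      also have "\<dots> \<le> (K * sqnorm n w) * Re (sesq n P u u)"
        using K(2)[of w] complex_Re_le_cmod[of "sesq n P w w"] nonneg
        by (intro mult_right_mono) linarith+
      finally have "sqnorm n w * sqnorm n w \<le> sqnorm n w * (K * Re (sesq n P u u))"
        by (simp add: power2_eq_square mult_ac)
      then show ?thesis using False sqnorm_nonneg[of n w] by simp
    qed (use K nonneg in simp)
    have "L * sqnorm n w \<le> L * (K * Re (sesq n P u u))"
      using w L(1) by (intro mult_left_mono) auto
    with uw have "sqnorm n u \<le> L * (K * Re (sesq n P u u))" by simp
    then show ?thesis using K(1) L(1) by (simp add: field_simps)
  qed
  with K(1) L(1) that[of "1 / (L * K)"] show thesis by simp
qed

text \<open>The largest \<open>m\<close> with \<open>m |u|\<^sup>2 \<le> (H u, u)\<close> is an eigenvalue: otherwise the semidefinite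
  \<open>H - m\<close> would be invertible, hence coercive, and \<open>m\<close> could be increased.\<close>

lemma hermitian_lowest_eigenvalue:
  assumes H: "H \<in> carrier_mat n n" and n: "0 < n" and h: "herm n (entries H)"
  obtains m :: real where "eigenvalue H (complex_of_real m)"
    "\<And>u. m * sqnorm n u \<le> Re (sesq n (entries H) u u)"
proof -
  let ?q = "\<lambda>u. Re (sesq n (entries H) u u)"
  define S where "S = {x. \<forall>u. x * sqnorm n u \<le> ?q u}"
  define m where "m = Sup S"
  obtain K where K: "0 < K" "\<And>u. cmod (sesq n (entries H) u u) \<le> K * sqnorm n u"
    using sesq_bounded[of n "entries H"] by blast
  have "- K \<in> S"
    unfolding S_def
  proof (intro CollectI allI)
    fix u show "- K * sqnorm n u \<le> ?q u"
      using K(2)[of u] abs_Re_le_cmod[of "sesq n (entries H) u u"] by linarith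
  qed
  then have ne: "S \<noteq> {}" by auto
  have below: "x \<le> ?q u / sqnorm n u" if "x \<in> S" "0 < sqnorm n u" for x u
    using that by (simp add: S_def field_simps)
  have bdd: "bdd_above S"
  proof -
    have "sqnorm n (unitv 0) \<noteq> 0" using n by (auto simp: sqnorm_eq_0_iff unitv_def)
    then have "0 < sqnorm n (unitv 0)" using sqnorm_nonneg[of n "unitv 0"] by simp
    then show ?thesis using below by (intro bdd_aboveI)
  qed
  have mS: "m * sqnorm n u \<le> ?q u" for u
  proof (cases "sqnorm n u = 0")
    case False
    then have pos: "0 < sqnorm n u" using sqnorm_nonneg[of n u] by simp
    then have "m \<le> ?q u / sqnorm n u"
      unfolding m_def using below ne by (intro cSup_least) auto
    then show ?thesis using pos by (simp add: field_simps)
  qed (simp add: sesq_eq_0_of_sqnorm_eq_0)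
  have "eigenvalue H (complex_of_real m)"
  proof (rule ccontr)
    let ?C = "char_matrix H (complex_of_real m)"
    define P where "P = (\<lambda>i j. H $$ (i, j) + (if i = j then - complex_of_real m else 0))"
    assume "\<not> ?thesis"
    then have "det ?C \<noteq> 0" by (simp add: eigenvalue_det[OF H])
    moreover have C: "?C \<in> carrier_mat n n" using H by (simp add: char_matrix_def)
    ultimately obtain Q where Q: "Q \<in> carrier_mat n n" "Q * ?C = 1\<^sub>m n"
      using det_non_zero_imp_unit[OF C, of "()"] unfolding Units_def ring_mat_def by auto
    have PC: "?C $$ (i, j) = P i j" if "i < n" "j < n" for i j
      using that H by (auto simp: char_matrix_def P_def)
    have inv: "(\<Sum>l<n. Q $$ (i, l) * P l j) = (if i = j then 1 else 0)" if "i < n" "j < n" for i j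
    proof -
      have "(\<Sum>l<n. Q $$ (i, l) * P l j) = (Q * ?C) $$ (i, j)"
        using that Q(1) C PC by (auto simp: scalar_prod_def atLeast0LessThan intro!: sum.cong)
      then show ?thesis using that Q(2) by simp
    qed
    have P: "psd n P" unfolding P_def using psd_shift_below[OF h mS] .
    obtain e where e: "0 < e" "\<And>u. e * sqnorm n u \<le> Re (sesq n P u u)"
      using psd_invertible_coercive[OF P inv] by blast
    have "m + e \<in> S"
      using e(2) unfolding S_def P_def sesq_add_form sesq_id sum_cnj_mult_self
      by (simp add: algebra_simps)
    then have "m + e \<le> m" unfolding m_def by (rule cSup_upper[OF _ bdd])
    then show False using e(1) by simp
  qed
  with mS that show thesis by blast
qed

lemma mult_mat_vec_index:
  assumes "X \<in> carrier_mat n n" "v \<in> carrier_vec n" "i < n"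
  shows "(X *\<^sub>v v) $ i = (\<Sum>j<n. X $$ (i, j) * v $ j)"
  using assms by (auto simp: scalar_prod_def atLeast0LessThan intro!: sum.cong)

lemma cscalar_prod_eq_sesq:
  assumes "X \<in> carrier_mat n n" "v \<in> carrier_vec n"
  shows "(X *\<^sub>v v) \<bullet>c v = sesq n (entries X) (\<lambda>i. v $ i) (\<lambda>i. v $ i)"
proof -
  have "(X *\<^sub>v v) \<bullet>c v = (\<Sum>i<n. (X *\<^sub>v v) $ i * cnj (v $ i))"
    using assms by (auto simp: scalar_prod_def atLeast0LessThan intro!: sum.cong)
  also have "\<dots> = (\<Sum>i<n. cnj (v $ i) * (\<Sum>j<n. X $$ (i, j) * v $ j))"
    using mult_mat_vec_index[OF assms] by (intro sum.cong) auto
  finally show ?thesis by (simp add: sesq_mult_vec)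
qed

lemma hermitian_mat_herm:
  assumes "hermitian_mat X" "X \<in> carrier_mat n n"
  shows "herm n (entries X)"
  unfolding herm_def
proof (intro allI impI)
  fix i j assume ij: "i < n" "j < n"
  have "mat_adjoint X $$ (j, i) = cnj (X $$ (i, j))"
    using ij assms(2) by (simp add: mat_adjoint_def mat_of_rows_def)
  then show "cnj (X $$ (i, j)) = X $$ (j, i)" using assms(1) by (simp add: hermitian_mat_def)
qed

lemma pos_def_mat_sesq_pos:
  assumes X: "pos_def_mat X" "X \<in> carrier_mat n n" and u: "i < n" "u i \<noteq> 0"
  shows "0 < Re (sesq n (entries X) u u)"
proof -
  define v where "v = vec n u"
  have v: "v \<in> carrier_vec n" by (simp add: v_def)
  have "v $ i \<noteq> 0\<^sub>v n $ i" using u by (simp add: v_def)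
  then have "v \<noteq> 0\<^sub>v n" by auto
  then have "0 < Re ((X *\<^sub>v v) \<bullet>c v)"
    using X v unfolding pos_def_mat_def by (metis carrier_matD(1))
  also have "(X *\<^sub>v v) \<bullet>c v = sesq n (entries X) u u"
    unfolding cscalar_prod_eq_sesq[OF X(2) v] by (intro sesq_cong) (auto simp: v_def)
  finally show ?thesis .
qed

lemma eigenvalue_square:
  fixes X :: "complex mat"
  assumes X: "X \<in> carrier_mat n n" and v: "v \<in> carrier_vec n" "v \<noteq> 0\<^sub>v n" "X *\<^sub>v v = c \<cdot>\<^sub>v v"
  shows "eigenvalue (X * X) (c\<^sup>2)"
proof -
  have "(X * X) *\<^sub>v v = X *\<^sub>v (X *\<^sub>v v)" by (rule assoc_mult_mat_vec[OF X X v(1)])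
  also have "\<dots> = c \<cdot>\<^sub>v (c \<cdot>\<^sub>v v)" unfolding v(3) mult_mat_vec[OF X v(1)] v(3) ..
  also have "\<dots> = c\<^sup>2 \<cdot>\<^sub>v v" by (simp add: smult_smult_assoc power2_eq_square)
  finally show ?thesis using X v unfolding eigenvalue_def eigenvector_def by auto
qed

lemma finite_real_eigenvalues:
  assumes "X \<in> carrier_mat n n"
  shows "finite {r. eigenvalue X (complex_of_real r)}"
proof -
  have "char_poly X \<noteq> 0" using degree_monic_char_poly[OF assms] by auto
  then have "finite {z. poly (char_poly X) z = 0}" by (rule poly_roots_finite)
  then have "finite {z. eigenvalue X z}" by (simp add: eigenvalue_root_char_poly[OF assms])
  then have "finite (complex_of_real -` {z. eigenvalue X z})"
    by (rule finite_vimageI) (simp add: inj_def)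
  then show ?thesis by (simp add: vimage_def)
qed

lemma pos_def_square_eigenvalue_pos:
  assumes B: "B \<in> carrier_mat n n" "pos_def_mat B" and r: "eigenvalue (B * B) (complex_of_real r)"
  shows "0 < r"
proof -
  have h: "herm n (entries B)" using B hermitian_mat_herm unfolding pos_def_mat_def by blast
  obtain v where v: "v \<in> carrier_vec n" "v \<noteq> 0\<^sub>v n" and ev: "(B * B) *\<^sub>v v = complex_of_real r \<cdot>\<^sub>v v"
    using r B(1) unfolding eigenvalue_def eigenvector_def by auto
  define u where "u i = v $ i" for i
  define w where "w i = (B *\<^sub>v v) $ i" for i
  obtain i where i: "i < n" "u i \<noteq> 0"
    using v unfolding u_def by (metis carrier_vecD eq_vecI index_zero_vec)
  have Bv: "B *\<^sub>v v \<in> carrier_vec n" using B(1) v by auto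
  have w: "(\<Sum>j<n. B $$ (l, j) * u j) = w l" if "l < n" for l
    using mult_mat_vec_index[OF B(1) v(1) that] by (simp add: u_def w_def)
  have Bw: "(\<Sum>j<n. B $$ (l, j) * w j) = complex_of_real r * u l" if "l < n" for l
    using mult_mat_vec_index[OF B(1) Bv that] ev v(1) that
    unfolding assoc_mult_mat_vec[OF B(1) B(1) v(1)] by (simp add: u_def w_def)
  have 1: "sesq n (entries B) w u = complex_of_real (sqnorm n w)"
    unfolding sesq_mult_vec sum_cnj_mult_self[symmetric] using w by (intro sum.cong) auto
  have "sesq n (entries B) u w = (\<Sum>l<n. complex_of_real r * (cnj (u l) * u l))"
    unfolding sesq_mult_vec using Bw by (intro sum.cong) (auto simp: mult_ac)
  then have 2: "sesq n (entries B) u w = complex_of_real (r * sqnorm n u)"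
    by (simp add: sum_distrib_left[symmetric] sum_cnj_mult_self)
  have "complex_of_real (sqnorm n w) = complex_of_real (r * sqnorm n u)"
    using sesq_swap[OF h, of u w] unfolding 1 2 by (metis complex_cnj_complex_of_real)
  then have eq: "sqnorm n w = r * sqnorm n u" by (simp only: of_real_eq_iff)
  have "sqnorm n w \<noteq> 0"
  proof
    assume "sqnorm n w = 0"
    then have "sesq n (entries B) u u = 0"
      unfolding sesq_mult_vec using w by (simp add: sqnorm_eq_0_iff)
    then show False using pos_def_mat_sesq_pos[of B n i u] B i by simp
  qed
  then have "0 < r * sqnorm n u" using sqnorm_nonneg[of n w] unfolding eq by linarith
  then show ?thesis using sqnorm_nonneg[of n u] by (simp add: zero_less_mult_iff)
qed

text \<open>The Rayleigh quotient of \<open>B\<close> lies between two eigenvalues \<open>m\<close> and \<open>M\<close>, found by applying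
  \<open>hermitian_lowest_eigenvalue\<close> to \<open>B\<close> and to \<open>- B\<close>. Their squares are eigenvalues of \<open>B\<^sup>* B = B\<^sup>2\<close>, all of whose real
  eigenvalues are positive, so the condition number is at least \<open>M / m\<close>; this inequality suffices,
  and it avoids determining the extreme eigenvalues of \<open>B\<^sup>2\<close> exactly.\<close>

lemma spectral_cond_rayleigh_bounds:
  assumes B: "B \<in> carrier_mat n n" and n: "0 < n" and pd: "pos_def_mat B"
  obtains m where "0 < m" "\<And>u. m * sqnorm n u \<le> Re (sesq n (entries B) u u)"
    "\<And>u. Re (sesq n (entries B) u u) \<le> spectral_cond B * m * sqnorm n u"
proof -
  have h: "herm n (entries B)" and adj: "mat_adjoint B = B"
    using B pd hermitian_mat_herm unfolding pos_def_mat_def hermitian_mat_def by blast+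
  obtain m where m: "eigenvalue B (complex_of_real m)"
    and lo: "\<And>u. m * sqnorm n u \<le> Re (sesq n (entries B) u u)"
    using hermitian_lowest_eigenvalue[OF B n h] by blast
  have B': "- B \<in> carrier_mat n n" using B by simp
  have neg: "sesq n (entries (- B)) u u = - sesq n (entries B) u u" for u
  proof -
    have "sesq n (entries (- B)) u u = sesq n (\<lambda>i j. - 1 * B $$ (i, j)) u u"
      using B by (intro sesq_cong) auto
    then show ?thesis unfolding sesq_scale_form by simp
  qed
  have "herm n (entries (- B))" using h B by (auto simp: herm_def)
  then obtain m' where m': "eigenvalue (- B) (complex_of_real m')"
    and hi: "\<And>u. m' * sqnorm n u \<le> Re (sesq n (entries (- B)) u u)"
    using hermitian_lowest_eigenvalue[OF B' n] by blast
  define M where "M = - m'"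
  have hi: "Re (sesq n (entries B) u u) \<le> M * sqnorm n u" for u
    using hi[of u] unfolding neg M_def by simp
  let ?E = "{r. eigenvalue (B * B) (complex_of_real r)}"
  have fin: "finite ?E" using B by (intro finite_real_eigenvalues) auto
  obtain v where v: "v \<in> carrier_vec n" "v \<noteq> 0\<^sub>v n" and Bv: "B *\<^sub>v v = complex_of_real m \<cdot>\<^sub>v v"
    using m B unfolding eigenvalue_def eigenvector_def by auto
  have "eigenvalue (B * B) ((complex_of_real m)\<^sup>2)" by (rule eigenvalue_square[OF B v Bv])
  then have mE: "m\<^sup>2 \<in> ?E" by simp
  obtain v' where v': "v' \<in> carrier_vec n" "v' \<noteq> 0\<^sub>v n"
    and "(- B) *\<^sub>v v' = complex_of_real m' \<cdot>\<^sub>v v'"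
    using m' B unfolding eigenvalue_def eigenvector_def by auto
  then have "eigenvalue (- B * - B) ((complex_of_real m')\<^sup>2)" by (intro eigenvalue_square[OF B'])
  moreover have "- B * - B = B * B" using B by simp
  ultimately have ME: "M\<^sup>2 \<in> ?E" by (simp add: M_def)
  obtain i where i: "i < n" "v $ i \<noteq> 0"
    using v by (metis carrier_vecD eq_vecI index_zero_vec)
  have m0: "0 < m"
  proof -
    have "sesq n (entries B) (\<lambda>i. v $ i) (\<lambda>i. v $ i)
        = (\<Sum>l<n. complex_of_real m * (cnj (v $ l) * v $ l))"
      unfolding sesq_mult_vec using mult_mat_vec_index[OF B v(1)] Bv v(1)
      by (intro sum.cong) (auto simp: mult_ac)
    then have "Re (sesq n (entries B) (\<lambda>i. v $ i) (\<lambda>i. v $ i)) = m * sqnorm n (\<lambda>i. v $ i)"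
      by (simp add: sum_distrib_left[symmetric] sum_cnj_mult_self)
    then have "0 < m * sqnorm n (\<lambda>i. v $ i)"
      using pos_def_mat_sesq_pos[OF pd B, where i = i and u = "\<lambda>i. v $ i"] i by simp
    then show ?thesis using sqnorm_nonneg[of n "\<lambda>i. v $ i"] by (simp add: zero_less_mult_iff)
  qed
  have "0 < sqnorm n (unitv 0)"
    using n sqnorm_nonneg[of n "unitv 0"] sqnorm_eq_0_iff[of n "unitv 0"] by (force simp: unitv_def)
  moreover have "m * sqnorm n (unitv 0) \<le> M * sqnorm n (unitv 0)"
    using lo[of "unitv 0"] hi[of "unitv 0"] by linarith
  ultimately have mM: "m \<le> M" by simp
  have "M\<^sup>2 \<le> lambda_max (B * B)" unfolding lambda_max_def by (rule Max_ge[OF fin ME])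
  moreover have "lambda_min (B * B) \<le> m\<^sup>2" unfolding lambda_min_def by (rule Min_le[OF fin mE])
  moreover have "0 < lambda_min (B * B)"
    using Min_in[OF fin] mE pos_def_square_eigenvalue_pos[OF B pd]
    unfolding lambda_min_def by blast
  ultimately have "M\<^sup>2 / m\<^sup>2 \<le> lambda_max (B * B) / lambda_min (B * B)"
    using zero_le_power2[of M] by (intro frac_le) linarith+
  then have "sqrt (M\<^sup>2 / m\<^sup>2) \<le> spectral_cond B"
    unfolding spectral_cond_def adj by (rule real_sqrt_le_mono)
  then have "M / m \<le> spectral_cond B" using m0 mM by (simp add: real_sqrt_divide)
  then have "M \<le> spectral_cond B * m" using m0 by (simp add: field_simps)
  then have "Re (sesq n (entries B) u u) \<le> spectral_cond B * m * sqnorm n u" for u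
    using hi[of u] sqnorm_nonneg[of n u] by (meson mult_right_mono order_trans)
  with m0 lo that show thesis by blast
qed

section \<open>Gaussian elimination\<close>

lemma ge_step_carrier: "X \<in> carrier_mat n n \<Longrightarrow> ge_step k X \<in> carrier_mat n n"
  by (auto simp: ge_step_def)

lemma ge_iter_carrier: "X \<in> carrier_mat n n \<Longrightarrow> ge_iter X k \<in> carrier_mat n n"
  by (induction k) (auto simp: ge_step_carrier)

lemma ge_iter_frozen_row:
  assumes X: "X \<in> carrier_mat n n" and ij: "i < n" "j < n" and "i \<le> k"
  shows "ge_iter X k $$ (i, j) = ge_iter X i $$ (i, j)"
  using \<open>i \<le> k\<close>
proof (induction k rule: dec_induct)
  case (step k)
  then show ?case
    using ij ge_iter_carrier[OF X, of k] by (simp add: ge_step_def)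
qed simp

text \<open>These are the vectors \<open>p\<close> for which \<open>p\<^sup>* X\<close> is row \<open>i\<close> of \<open>X\<close> plus a combination of the rows
  above row \<open>k\<close>, as produced by the first \<open>k\<close> elimination steps.\<close>

definition elimination_vector :: "nat \<Rightarrow> nat \<Rightarrow> (nat \<Rightarrow> complex) \<Rightarrow> bool"
  where "elimination_vector k i p \<longleftrightarrow> p i = 1 \<and> (\<forall>l\<ge>k. l \<noteq> i \<longrightarrow> p l = 0)"

text \<open>Each coordinate contributes zero except the \<open>i\<close>-th: in the leading ones \<open>p\<^sup>* X\<close>
  vanishes, in the remaining ones \<open>p\<close> does. This is the identity \<open>a(p,p) = a(p,e\<^sub>i)\<close> on which the Schur complement bound rests.\<close>

lemma elimination_pairing:
  assumes p: "elimination_vector k i p" and "i < n"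
    and zero: "\<And>j. j < k \<Longrightarrow> (\<Sum>l<n. cnj (p l) * X l j) = 0"
  shows "sesq n X p p = (\<Sum>l<n. cnj (p l) * X l i)"
proof -
  have "(\<Sum>l<n. cnj (p l) * X l j) * p j = (if j = i then \<Sum>l<n. cnj (p l) * X l i else 0)" for j
    using p zero[of j] by (cases "j < k") (auto simp: elimination_vector_def)
  then show ?thesis using \<open>i < n\<close> unfolding sesq_expand_right by simp
qed

text \<open>Definiteness keeps the elimination alive: the pivot in step \<open>k\<close> is the value \<open>(X q, q)\<close> of
  the form at the vector \<open>q\<close> that produces row \<open>k\<close>, and \<open>q\<close> is not zero as its \<open>k\<close>-th
  coordinate is 1.\<close>

lemma ge_iter_row_combination:
  assumes X: "X \<in> carrier_mat n n"
    and definite: "\<And>u. \<exists>i<n. u i \<noteq> 0 \<Longrightarrow> sesq n (entries X) u u \<noteq> 0"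
    and "k \<le> i" "i < n"
  obtains p where "elimination_vector k i p"
    "\<And>j. j < n \<Longrightarrow> ge_iter X k $$ (i, j) = (\<Sum>l<n. cnj (p l) * X $$ (l, j))"
    "\<And>j. j < k \<Longrightarrow> ge_iter X k $$ (i, j) = 0"
proof -
  have "\<exists>p. elimination_vector k i p
      \<and> (\<forall>j<n. ge_iter X k $$ (i, j) = (\<Sum>l<n. cnj (p l) * X $$ (l, j)))
      \<and> (\<forall>j<k. ge_iter X k $$ (i, j) = 0)"
    using \<open>k \<le> i\<close> \<open>i < n\<close>
  proof (induction k arbitrary: i)
    case 0
    have "(\<Sum>l<n. cnj (unitv i l) * X $$ (l, j)) = X $$ (i, j)" for j
    proof -
      have "(\<Sum>l<n. cnj (unitv i l) * X $$ (l, j)) = (\<Sum>l<n. if l = i then X $$ (l, j) else 0)"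
        by (intro sum.cong) (auto simp: unitv_def)
      then show ?thesis using 0 by simp
    qed
    then show ?case
      by (intro exI[of _ "unitv i"]) (auto simp: elimination_vector_def unitv_def)
  next
    case (Suc k)
    let ?Y = "ge_iter X k"
    from Suc.IH[of i] Suc.prems obtain p where p: "elimination_vector k i p"
      and pY: "\<And>j. j < n \<Longrightarrow> ?Y $$ (i, j) = (\<Sum>l<n. cnj (p l) * X $$ (l, j))"
      and p0: "\<And>j. j < k \<Longrightarrow> ?Y $$ (i, j) = 0"
      by auto
    from Suc.IH[of k] Suc.prems obtain q where q: "elimination_vector k k q"
      and qY: "\<And>j. j < n \<Longrightarrow> ?Y $$ (k, j) = (\<Sum>l<n. cnj (q l) * X $$ (l, j))"
      and q0: "\<And>j. j < k \<Longrightarrow> ?Y $$ (k, j) = 0"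
      by auto
    have k: "k < n" using Suc.prems by simp
    have "sesq n (entries X) q q = (\<Sum>l<n. cnj (q l) * X $$ (l, k))"
      using q0 qY k by (intro elimination_pairing[OF q k]) auto
    moreover have "sesq n (entries X) q q \<noteq> 0"
      by (rule definite, rule exI[of _ k]) (use q k in \<open>simp add: elimination_vector_def\<close>)
    ultimately have pivot: "?Y $$ (k, k) \<noteq> 0" using qY[OF k] by simp
    define c where "c = ?Y $$ (i, k) / ?Y $$ (k, k)"
    \<comment> \<open>\<open>cnj\<close>, because \<open>p\<close> enters the row combination conjugated\<close>
    define p' where "p' l = p l - cnj c * q l" for l
    have step: "ge_iter X (Suc k) $$ (i, j) = ?Y $$ (i, j) - c * ?Y $$ (k, j)" if "j < n" for j
      using that Suc.prems ge_iter_carrier[OF X, of k] by (simp add: ge_step_def c_def)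
    have "elimination_vector (Suc k) i p'"
      using p q Suc.prems by (auto simp: elimination_vector_def p'_def)
    moreover have "ge_iter X (Suc k) $$ (i, j) = (\<Sum>l<n. cnj (p' l) * X $$ (l, j))" if "j < n" for j
      unfolding step[OF that] pY[OF that] qY[OF that] p'_def
      by (simp add: algebra_simps sum_subtractf sum_distrib_left)
    moreover have "ge_iter X (Suc k) $$ (i, j) = 0" if "j < Suc k" for j
    proof (cases "j = k")
      case True
      then show ?thesis using step[of k] k pivot by (simp add: c_def)
    next
      case False
      then show ?thesis using that step[of j] k p0[of j] q0[of j] by simp
    qed
    ultimately show ?case by blast
  qed
  with that show thesis by blast
qed

text \<open>Scaling the trailing blocks by \<open>\<rho>\<close> leaves the leading columns of \<open>A\<close> alone, so \<open>p\<close> eliminates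
  the scaled matrix as well, and the entry it produces there differs from that of the
  Schur complement of \<open>A\<close> by \<open>(1 - \<rho>) A\<^sub>i\<^sub>j\<close>. That entry is at most \<open>2 \<rho> \<mu>\<close>, which gives
  \<open>(1 - \<rho>) \<mu> + 2 \<rho> \<mu>\<close> in total.\<close>

lemma schur_complement_entry_bound:
  fixes \<mu> \<rho> :: real
  assumes B: "psd n (scale_trailing k \<rho> B)" and C: "psd n (scale_trailing k \<rho> C)"
    and \<rho>: "0 \<le> \<rho>" "\<rho> \<le> 1"
    and A: "\<And>i j. i < n \<Longrightarrow> j < n \<Longrightarrow> A i j = B i j + \<i> * C i j"
    and ij: "k \<le> i" "i < n" "k \<le> j" "j < n"
    and p: "elimination_vector k i p"
    and zero: "\<And>j. j < k \<Longrightarrow> (\<Sum>l<n. cnj (p l) * A l j) = 0"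
    and \<mu>: "cmod (A i j) \<le> \<mu>" "cmod (A i i) \<le> \<mu>" "cmod (A j j) \<le> \<mu>"
  shows "cmod (\<Sum>l<n. cnj (p l) * A l j) \<le> (1 + \<rho>) * \<mu>"
proof -
  let ?S = "scale_trailing k \<rho>"
  define a where "a u v = sesq n (?S B) u v + \<i> * sesq n (?S C) u v" for u v
  have a: "a u v = sesq n (?S A) u v" for u v
    unfolding a_def sesq_scale_form[symmetric] sesq_add_form[symmetric]
    by (intro sesq_cong) (auto simp: scale_trailing_def A algebra_simps)
  have lead: "(\<Sum>l<n. cnj (p l) * ?S A l m) = 0" if "m < k" for m
    using zero[OF that] that by (simp add: scale_trailing_def)
  have trail: "(\<Sum>l<n. cnj (p l) * ?S A l m)
      = (\<Sum>l<n. cnj (p l) * A l m) - (1 - \<rho>) * A i m" if "k \<le> m" for m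
  proof -
    have "cnj (p l) * ?S A l m
        = cnj (p l) * A l m - (if l = i then (1 - \<rho>) * A i m else 0)" for l
      using p ij that by (auto simp: elimination_vector_def scale_trailing_def algebra_simps)
    then show ?thesis using ij by (simp add: sum_subtractf)
  qed
  have "a p p = a p (unitv i)"
    unfolding a using elimination_pairing[OF p \<open>i < n\<close> lead] ij by (simp add: sesq_unitv_right)
  then have "(cmod (a p (unitv j)))\<^sup>2
      \<le> 4 * cmod (a (unitv i) (unitv i)) * cmod (a (unitv j) (unitv j))"
    by (intro accretive_dissipative_schur_bound[OF B C a_def])
  also have "\<dots> = 4 * (\<rho> * cmod (A i i)) * (\<rho> * cmod (A j j))"
    unfolding a using ij \<rho> by (simp add: sesq_unitv scale_trailing_def norm_mult)
  also have "\<dots> \<le> 4 * (\<rho> * \<mu>) * (\<rho> * \<mu>)"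
  proof -
    have "0 \<le> \<mu>" using \<mu>(1) norm_ge_zero order_trans by blast
    then show ?thesis using \<mu> \<rho> by (intro mult_mono mult_nonneg_nonneg) auto
  qed
  also have "\<dots> = (2 * \<rho> * \<mu>)\<^sup>2" by (simp add: power2_eq_square)
  finally have *: "cmod (a p (unitv j)) \<le> 2 * \<rho> * \<mu>"
    by (rule power2_le_imp_le) (use \<rho> \<mu>(1) norm_ge_zero[of "A i j"] in \<open>simp del: norm_ge_zero\<close>)
  have "(\<Sum>l<n. cnj (p l) * A l j) = a p (unitv j) + (1 - \<rho>) * A i j"
    unfolding a using ij trail[of j] by (simp add: sesq_unitv_right)
  then have "cmod (\<Sum>l<n. cnj (p l) * A l j) \<le> cmod (a p (unitv j)) + cmod ((1 - \<rho>) * A i j)"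
    by (metis norm_triangle_ineq)
  also have "cmod ((1 - \<rho>) * A i j) = (1 - \<rho>) * cmod (A i j)"
    using \<rho> unfolding norm_mult norm_of_real by simp
  also have "\<dots> \<le> (1 - \<rho>) * \<mu>" using \<mu> \<rho> by (intro mult_left_mono) auto
  finally show ?thesis using * by (simp add: algebra_simps)
qed

lemma generalized_higham_definite:
  assumes B: "B \<in> carrier_mat n n" "pos_def_mat B" and C: "C \<in> carrier_mat n n" "pos_def_mat C"
    and i: "i < n" "u i \<noteq> 0"
  shows "sesq n (entries (B + \<i> \<cdot>\<^sub>m C)) u u \<noteq> 0"
proof -
  have "herm n (entries C)" using C hermitian_mat_herm unfolding pos_def_mat_def by blast
  then have im: "Im (sesq n (entries C) u u) = 0" using sesq_diag_real by (metis Im_complex_of_real)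
  have "sesq n (entries (B + \<i> \<cdot>\<^sub>m C)) u u = sesq n (\<lambda>i j. B $$ (i, j) + \<i> * C $$ (i, j)) u u"
    using B C by (intro sesq_cong) auto
  then have "Re (sesq n (entries (B + \<i> \<cdot>\<^sub>m C)) u u) = Re (sesq n (entries B) u u)"
    using im by (simp add: sesq_add_form sesq_scale_form)
  then show ?thesis using pos_def_mat_sesq_pos[of B n i u] B i by auto
qed

lemma ge_iter_entry_bound:
  fixes \<kappa> \<mu> :: real
  assumes B: "B \<in> carrier_mat n n" "pos_def_mat B" and C: "C \<in> carrier_mat n n" "pos_def_mat C"
    and A: "A = B + \<i> \<cdot>\<^sub>m C"
    and \<kappa>: "1 \<le> \<kappa>" "spectral_cond B \<le> \<kappa>" "spectral_cond C \<le> \<kappa>"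
    and \<mu>: "\<And>i j. i < n \<Longrightarrow> j < n \<Longrightarrow> cmod (A $$ (i, j)) \<le> \<mu>"
    and ij: "i < n" "j < n"
  shows "cmod (ge_iter A k $$ (i, j)) \<le> (1 + ((\<kappa> - 1) / (\<kappa> + 1))\<^sup>2) * \<mu>"
proof -
  define \<rho> where "\<rho> = ((\<kappa> - 1) / (\<kappa> + 1))\<^sup>2"
  have \<rho>: "0 \<le> \<rho>" "\<rho> \<le> 1"
    using \<kappa>(1) unfolding \<rho>_def by (auto intro!: power_le_one)
  have Ac: "A \<in> carrier_mat n n" using B C A by auto
  have psd: "psd n (scale_trailing h \<rho> (entries X))"
    if X: "X \<in> carrier_mat n n" "pos_def_mat X" "spectral_cond X \<le> \<kappa>" for X h
  proof -
    have "0 < n" using ij by simp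
    then obtain m where m: "0 < m" "\<And>u. m * sqnorm n u \<le> Re (sesq n (entries X) u u)"
      and hi: "\<And>u. Re (sesq n (entries X) u u) \<le> spectral_cond X * m * sqnorm n u"
      using spectral_cond_rayleigh_bounds[OF X(1) _ X(2)] by blast
    have "spectral_cond X * m * sqnorm n u \<le> \<kappa> * m * sqnorm n u" for u
      using X(3) m(1) sqnorm_nonneg[of n u] by (intro mult_right_mono) auto
    then have "Re (sesq n (entries X) u u) \<le> \<kappa> * m * sqnorm n u" for u
      using hi[of u] order_trans by blast
    moreover have "herm n (entries X)"
      using X hermitian_mat_herm unfolding pos_def_mat_def by blast
    ultimately show ?thesis
      unfolding \<rho>_def using m \<kappa>(1) by (intro psd_scale_trailing) auto
  qed
  \<comment> \<open>row \<open>i\<close> is last modified in the step with pivot \<open>i - 1\<close>, so for \<open>i < k\<close> it is the row of stage \<open>i\<close>\<close>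
  define h where "h = min i k"
  have h: "h \<le> i" by (simp add: h_def)
  have frozen: "ge_iter A k $$ (i, j) = ge_iter A h $$ (i, j)"
    using ge_iter_frozen_row[OF Ac ij, of k] by (auto simp: h_def min_def)
  have definite: "sesq n (entries A) u u \<noteq> 0" if "\<exists>i<n. u i \<noteq> 0" for u
    unfolding A using that generalized_higham_definite[OF B C] by blast
  obtain p where p: "elimination_vector h i p"
    and row: "\<And>j. j < n \<Longrightarrow> ge_iter A h $$ (i, j) = (\<Sum>l<n. cnj (p l) * A $$ (l, j))"
    and zero: "\<And>j. j < h \<Longrightarrow> ge_iter A h $$ (i, j) = 0"
    using ge_iter_row_combination[OF Ac definite h ij(1)] by blast
  have "0 \<le> cmod (A $$ (i, j))" by simp
  then have \<mu>0: "0 \<le> \<mu>" using \<mu>[OF ij] by linarith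
  show ?thesis
  proof (cases "j < h")
    case True
    then show ?thesis using frozen zero \<mu>0 by (simp add: \<rho>_def[symmetric] \<rho>)
  next
    case False
    have "cmod (\<Sum>l<n. cnj (p l) * A $$ (l, j)) \<le> (1 + \<rho>) * \<mu>"
    proof (rule schur_complement_entry_bound[OF psd psd \<rho> _ h ij(1) _ ij(2) p])
      show "A $$ (i, j) = B $$ (i, j) + \<i> * C $$ (i, j)" if "i < n" "j < n" for i j
        using that B C by (simp add: A)
      show "(\<Sum>l<n. cnj (p l) * A $$ (l, j)) = 0" if "j < h" for j
        using zero[OF that] row[of j] that h ij by simp
    qed (use B C \<kappa> \<mu> ij False in auto)
    then show ?thesis using frozen row[OF ij(2)] by (simp add: \<rho>_def)
  qed
qed

lemma one_le_spectral_cond: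
  assumes B: "B \<in> carrier_mat n n" and n: "0 < n" and pd: "pos_def_mat B"
  shows "1 \<le> spectral_cond B"
proof -
  obtain m where m: "0 < m" "\<And>u. m * sqnorm n u \<le> Re (sesq n (entries B) u u)"
    "\<And>u. Re (sesq n (entries B) u u) \<le> spectral_cond B * m * sqnorm n u"
    using spectral_cond_rayleigh_bounds[OF assms] by blast
  have "sqnorm n (unitv 0) \<noteq> 0" using n by (auto simp: sqnorm_eq_0_iff unitv_def)
  then have pos: "0 < m * sqnorm n (unitv 0)" using m(1) sqnorm_nonneg[of n "unitv 0"] by simp
  have "1 * (m * sqnorm n (unitv 0)) \<le> spectral_cond B * (m * sqnorm n (unitv 0))"
    using m(2)[of "unitv 0"] m(3)[of "unitv 0"] by (simp add: mult.assoc)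
  then show ?thesis using pos by (simp only: mult_le_cancel_right_pos)
qed

theorem theorem2p9:
  fixes A B C :: "complex mat" and n :: nat and \<kappa> :: real
  assumes "n \<ge> 1"
    and "A \<in> carrier_mat n n"
    and "B \<in> carrier_mat n n"
    and "C \<in> carrier_mat n n"
    and "A = B + \<i> \<cdot>\<^sub>m C"
    and "pos_def_mat B"
    and "pos_def_mat C"
    and "\<kappa> = max (spectral_cond B) (spectral_cond C)"
  shows "4 * \<kappa> / (1 + \<kappa>)\<^sup>2 \<le> growth_factor A
    \<and> growth_factor A \<le> 2 * (1 + \<kappa>\<^sup>2) / (1 + \<kappa>)\<^sup>2"
proof -
  define D where "D = {cmod (A $$ (i, j)) | i j. i < n \<and> j < n}"
  define N where "N = {cmod (ge_iter A k $$ (i, j)) | i j k. i < n \<and> j < n \<and> k < n}"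
  have gf: "growth_factor A = Max N / Max D"
    using assms(2) by (simp add: growth_factor_def N_def D_def)
  have "D = (\<lambda>(i, j). cmod (A $$ (i, j))) ` ({..<n} \<times> {..<n})"
    by (auto simp: D_def)
  then have finD: "finite D" by simp
  have "N = (\<lambda>(i, j, k). cmod (ge_iter A k $$ (i, j))) ` ({..<n} \<times> {..<n} \<times> {..<n})"
    by (force simp: N_def)
  then have finN: "finite N" by simp
  have D_le: "cmod (A $$ (i, j)) \<le> Max D" if "i < n" "j < n" for i j
    using that by (intro Max_ge[OF finD]) (auto simp: D_def)
  have n: "0 < n" using assms(1) by simp
  have "cmod (A $$ (0, 0)) \<in> D" using n by (auto simp: D_def)
  then have Dne: "D \<noteq> {}" by auto
  have DN: "D \<subseteq> N"
  proof
    fix x assume "x \<in> D"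
    then obtain i j where "x = cmod (ge_iter A 0 $$ (i, j))" "i < n" "j < n" by (auto simp: D_def)
    then show "x \<in> N" unfolding N_def using n by blast
  qed
  have "sesq n (entries A) (unitv 0) (unitv 0) \<noteq> 0"
    unfolding assms(5) using generalized_higham_definite[of B n C 0 "unitv 0"] assms n
    by (simp add: unitv_def)
  then have "0 < cmod (A $$ (0, 0))" using n by (simp add: sesq_unitv)
  with D_le[OF n n] have pos: "0 < Max D" by linarith
  have \<kappa>: "1 \<le> \<kappa>" "spectral_cond B \<le> \<kappa>" "spectral_cond C \<le> \<kappa>"
    using one_le_spectral_cond[OF assms(3) n assms(6)] assms(8) by auto
  have "Max D \<le> Max N" by (rule Max_mono[OF DN Dne finN])
  then have "1 \<le> growth_factor A" using pos by (simp add: gf)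
  moreover have "4 * \<kappa> / (1 + \<kappa>)\<^sup>2 \<le> 1"
    using \<kappa>(1) zero_le_power2[of "1 - \<kappa>"] by (simp add: power2_eq_square algebra_simps)
  moreover have "growth_factor A \<le> 2 * (1 + \<kappa>\<^sup>2) / (1 + \<kappa>)\<^sup>2"
  proof -
    have "Max N \<le> (1 + ((\<kappa> - 1) / (\<kappa> + 1))\<^sup>2) * Max D"
    proof (rule Max.boundedI[OF finN])
      show "N \<noteq> {}" using DN Dne by auto
      fix x assume "x \<in> N"
      then obtain i j k where "x = cmod (ge_iter A k $$ (i, j))" "i < n" "j < n"
        by (auto simp: N_def)
      then show "x \<le> (1 + ((\<kappa> - 1) / (\<kappa> + 1))\<^sup>2) * Max D"
        using ge_iter_entry_bound[OF assms(3,6,4,7,5) \<kappa> D_le] by simp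
    qed
    then have "growth_factor A \<le> 1 + ((\<kappa> - 1) / (\<kappa> + 1))\<^sup>2"
      unfolding gf using pos by (simp add: field_simps)
    also have "\<dots> = 2 * (1 + \<kappa>\<^sup>2) / (1 + \<kappa>)\<^sup>2"
    proof -
      have "(1 + \<kappa>)\<^sup>2 \<noteq> 0" using \<kappa>(1) by simp
      moreover have "(1 + \<kappa>)\<^sup>2 + (\<kappa> - 1)\<^sup>2 = 2 * (1 + \<kappa>\<^sup>2)"
        by (simp add: power2_eq_square algebra_simps)
      moreover have "1 + ((\<kappa> - 1) / (\<kappa> + 1))\<^sup>2 = ((1 + \<kappa>)\<^sup>2 + (\<kappa> - 1)\<^sup>2) / (1 + \<kappa>)\<^sup>2"
        using calculation(1) by (simp add: add_divide_distrib power_divide add.commute)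
      ultimately show ?thesis by metis
    qed
    finally show ?thesis .
  qed
  ultimately show ?thesis by linarith
qed

end
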